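(* Let $T$ be a tree of order $n\ge 3$, with distance matrix $\mathcal{D}(T)$. Then: (i) The coefficient sequence (of coefficients of $x^0,x^1,\dots,x^n$) of the distance characteristic polynomial $p_{\mathcal{D}(T)}(x)=\det(xI-\mathcal{D}(T))$ is log-concave. (ii) The sequence $|\delta_0(T)|,\dots,|\delta_{n-2}(T)|$ of absolute values of coefficients of the distance characteristic polynomial is log-concave and unimodal. (iii) The sequence $d_0(T),\dots,d_{n-2}(T)$ of normalized coefficients of the distance characteristic polynomial is log-concave and unimodal.
   Context: A tree is a finite simple undirected connected graph without cycles; its order $n$ is its number of vertices. The distance matrix $\mathcal{D}(G)$ of a connected graph $G$ is indexed by the vertices of $G$, with $(i,j)$-entry equal to the length of a shortest path between $v_i$ and $v_j$. For a graph $G$ on $n$ vertices, $\delta_k(G)$ denotes the coefficient of $x^k$ in $\det(\mathcal{D}(G)-xI)$, so the coefficient of $x^k$ in $p_{\mathcal{D}(G)}(x)=\det(xI-\mathcal{D}(G))$ is $(-1)^n\delta_k(G)$. For $0\le k\le n-2$ the normalized coefficients are $d_k(G)=\frac{1}{2^{n-2}}2^k|\delta_k(G)|$. A sequence $a_0,a_1,\dots,a_m$ of real numbers is unimodal if there is a $k$ such that $a_{i-1}\le a_i$ for $i\le k$ and $a_i\ge a_{i+1}$ for $i\ge k$ (for all indices for which these make sense); it is log-concave if $a_j^2\ge a_{j-1}a_{j+1}$ for all $j=1,\dots,m-1$. *)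

theory Defs
  imports "Graph_Theory.Digraph_Component" "Jordan_Normal_Form.Char_Poly"
begin

text \<open>
  A finite simple undirected graph is a graph in the sense of the locale \<^locale>\<open>graph\<close>, i.e. a
  finite symmetric digraph without loops and parallel arcs. The constant \<^const>\<open>forest\<close> (and hence
  \<^const>\<open>tree\<close>) of the library cannot be used for these: a pair of opposite arcs, which represents
  a single undirected edge, is already a \<^const>\<open>pre_digraph.cycle\<close> of length 2. The cycles of the
  undirected graph are exactly the directed cycles of length at least 3.
\<close>

definition undirected_tree :: "('a, 'b) pre_digraph \<Rightarrow> bool" where
  "undirected_tree G \<longleftrightarrow>
     graph G \<and> connected G \<and> \<not> (\<exists>p. pre_digraph.cycle G p \<and> 3 \<le> length p)"

definition graph_dist :: "('a, 'b) pre_digraph \<Rightarrow> 'a \<Rightarrow> 'a \<Rightarrow> nat" where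
  "graph_dist G u v = (LEAST k. \<exists>p. pre_digraph.apath G u p v \<and> length p = k)"

text \<open>The list \<open>vs\<close> enumerates the vertices and so fixes the order of the rows and columns.\<close>

definition dist_matrix :: "('a, 'b) pre_digraph \<Rightarrow> 'a list \<Rightarrow> real mat" where
  "dist_matrix G vs =
     mat (length vs) (length vs) (\<lambda>(i, j). real (graph_dist G (vs ! i) (vs ! j)))"

definition dist_char_poly :: "('a, 'b) pre_digraph \<Rightarrow> 'a list \<Rightarrow> real poly" where
  "dist_char_poly G vs = char_poly (dist_matrix G vs)"

text \<open>
  The coefficient of \<open>x\<^sup>k\<close> in \<open>det (D - x I)\<close>, in contrast to \<^const>\<open>char_poly\<close>, which is
  \<open>det (x I - D)\<close>. The indeterminate \<open>x\<close> is the polynomial \<open>[:0, 1:]\<close>.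
\<close>

definition dist_delta :: "('a, 'b) pre_digraph \<Rightarrow> 'a list \<Rightarrow> nat \<Rightarrow> real" where
  "dist_delta G vs k =
     coeff (det (map_mat (\<lambda>a. [:a:]) (dist_matrix G vs) - [:0, 1:] \<cdot>\<^sub>m 1\<^sub>m (length vs))) k"

definition dist_normalized_coeff :: "('a, 'b) pre_digraph \<Rightarrow> 'a list \<Rightarrow> nat \<Rightarrow> real" where
  "dist_normalized_coeff G vs k =
     1 / 2 ^ (card (verts G) - 2) * 2 ^ k * \<bar>dist_delta G vs k\<bar>"

text \<open>The finite sequence \<open>a 0, \<dots>, a m\<close> is given by a function \<open>a\<close> and its last index \<open>m\<close>.\<close>

definition unimodal :: "(nat \<Rightarrow> real) \<Rightarrow> nat \<Rightarrow> bool" where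
  "unimodal a m \<longleftrightarrow>
     (\<exists>k\<le>m. (\<forall>i. 1 \<le> i \<and> i \<le> k \<longrightarrow> a (i - 1) \<le> a i) \<and>
            (\<forall>i. k \<le> i \<and> i < m \<longrightarrow> a i \<ge> a (i + 1)))"

definition log_concave :: "(nat \<Rightarrow> real) \<Rightarrow> nat \<Rightarrow> bool" where
  "log_concave a m \<longleftrightarrow> (\<forall>j. 1 \<le> j \<and> j < m \<longrightarrow> (a j)\<^sup>2 \<ge> a (j - 1) * a (j + 1))"

end

theory Submission
  imports Defs "Jordan_Normal_Form.Schur_Decomposition"
    "HOL-Computational_Algebra.Fundamental_Theorem_Algebra"
begin

text \<open>
  The distance matrix \<open>D\<close> is symmetric, so its characteristic polynomial has only real roots, and
  Newton's inequalities make the coefficients log-concave. Newton's inequalities reduce to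
  \<open>2 a\<^sub>0 a\<^sub>2 \<le> a\<^sub>1\<^sup>2\<close> for real-rooted polynomials, because derivatives of real-rooted
  polynomials are real-rooted.

  For the absolute values, all coefficients up to \<open>x\<^sup>n\<^sup>-\<^sup>2\<close> have to be of the same sign. Attaching
  a pendant vertex \<open>v\<close> to \<open>p\<close> gives \<open>d(v, u) = 1 + d(p, u)\<close>, and by moving the weight of \<open>v\<close> to
  \<open>p\<close> it follows inductively that the quadratic form of \<open>D\<close> is nonpositive on vectors of sum zero.
  Two eigenvectors of positive eigenvalues would span a vector of sum zero on which the form is
  positive, so \<open>D\<close> has at most one positive eigenvalue. As the trace is zero, the characteristic
  polynomial is \<open>(x - \<Sum> u\<^sub>i) \<Prod> (x + u\<^sub>i)\<close> with all \<open>u\<^sub>i \<ge> 0\<close>, whose coefficients are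
  \<open>e\<^sub>m - e\<^sub>1 e\<^sub>m\<^sub>-\<^sub>1 \<le> 0\<close> for \<open>m \<ge> 2\<close>, and the zeros among these form an initial segment of the
  sequence, so that log-concavity implies unimodality.
\<close>

section \<open>Distances in trees\<close>

text \<open>In a tree the nonempty sets of this kind are the vertex sets of subtrees. Quantifying
  over paths of \<open>G\<close> itself, not of an induced subgraph, keeps all distances those of
  \<open>G\<close>.\<close>

definition path_convex :: "('a, 'b) pre_digraph \<Rightarrow> 'a set \<Rightarrow> bool" where
  "path_convex G S \<longleftrightarrow> S \<subseteq> verts G \<and>
     (\<forall>u\<in>S. \<forall>w\<in>S. \<forall>q. pre_digraph.apath G u q w \<longrightarrow> set (pre_digraph.awalk_verts G u q) \<subseteq> S)"

text \<open>Distances of negative type, that is, conditionally negative semidefinite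
  kernels.\<close>

definition neg_type_on :: "'a set \<Rightarrow> ('a \<Rightarrow> 'a \<Rightarrow> real) \<Rightarrow> bool" where
  "neg_type_on S d \<longleftrightarrow>
     (\<forall>x. (\<Sum>u\<in>S. x u) = 0 \<longrightarrow> (\<Sum>u\<in>S. \<Sum>w\<in>S. x u * x w * d u w) \<le> 0)"

text \<open>Moving the weight of \<open>v\<close> to \<open>p\<close> gives a vector
  \<open>y\<close> of sum zero on \<open>S\<close>. The form of \<open>x\<close> on the larger set
  is that of \<open>y\<close> on \<open>S\<close> minus twice the square of
  \<open>x v\<close>.\<close>

lemma neg_type_on_insert_pendant:
  fixes d :: "'a \<Rightarrow> 'a \<Rightarrow> real"
  assumes S: "finite S" "v \<notin> S" "p \<in> S" and nt: "neg_type_on S d"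
    and sym: "\<And>u. u \<in> S \<Longrightarrow> d u v = d v u"
    and sym': "\<And>u. u \<in> S \<Longrightarrow> d u p = d p u"
    and pend: "\<And>u. u \<in> S \<Longrightarrow> d v u = 1 + d p u"
    and refl: "d v v = 0" "d p p = 0"
  shows "neg_type_on (insert v S) d"
  unfolding neg_type_on_def
proof (intro allI impI)
  fix x :: "'a \<Rightarrow> real"
  assume sum0: "(\<Sum>u\<in>insert v S. x u) = 0"
  define y where "y u = x u + (if u = p then x v else 0)" for u
  define L where "L = (\<Sum>u\<in>S. x u * d p u)"
  define Q where "Q = (\<Sum>u\<in>S. \<Sum>w\<in>S. x u * x w * d u w)"
  have xS: "(\<Sum>u\<in>S. x u) = - x v" using sum0 S by simp
  have "(\<Sum>u\<in>S. y u) = 0"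
    using S xS by (simp add: y_def sum.distrib)
  hence nonpos: "(\<Sum>u\<in>S. \<Sum>w\<in>S. y u * y w * d u w) \<le> 0"
    using nt by (simp add: neg_type_on_def)
  have inner: "(\<Sum>w\<in>S. y w * d u w) = (\<Sum>w\<in>S. x w * d u w) + x v * d u p" for u
  proof -
    have "(\<Sum>w\<in>S. y w * d u w) = (\<Sum>w\<in>S. x w * d u w + (if w = p then x v * d u p else 0))"
      by (intro sum.cong) (auto simp: y_def algebra_simps)
    thus ?thesis using S by (simp add: sum.distrib)
  qed
  have "(\<Sum>u\<in>S. \<Sum>w\<in>S. y u * y w * d u w) = (\<Sum>u\<in>S. y u * ((\<Sum>w\<in>S. x w * d u w) + x v * d u p))"
    by (simp add: inner[symmetric] sum_distrib_left mult.assoc)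
  also have "\<dots> = (\<Sum>u\<in>S. x u * (\<Sum>w\<in>S. x w * d u w) + x v * (x u * d p u)
      + (if u = p then x v * (\<Sum>w\<in>S. x w * d p w) else 0))"
    by (intro sum.cong) (auto simp: y_def algebra_simps sym' refl)
  also have "\<dots> = Q + x v * L + x v * L"
    using S by (simp add: sum.distrib Q_def L_def sum_distrib_left mult.assoc)
  finally have Q: "Q + 2 * (x v * L) \<le> 0" using nonpos by (simp add: mult.commute)
  have V: "(\<Sum>u\<in>S. x u * d v u) = L - x v"
    using xS by (simp add: pend L_def distrib_left sum.distrib)
  have "(\<Sum>u\<in>insert v S. \<Sum>w\<in>insert v S. x u * x w * d u w)
      = (\<Sum>w\<in>S. x v * (x w * d v w)) + (\<Sum>u\<in>S. x v * (x u * d v u) + (\<Sum>w\<in>S. x u * x w * d u w))"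
    using S by (simp add: refl sym mult_ac cong: sum.cong)
  also have "\<dots> = 2 * (x v * (L - x v)) + Q"
    by (simp add: sum.distrib Q_def V flip: sum_distrib_left)
  also have "\<dots> = (Q + 2 * (x v * L)) - 2 * (x v)\<^sup>2"
    by (simp add: algebra_simps power2_eq_square)
  also have "\<dots> \<le> 0" using Q zero_le_power2[of "x v"] by linarith
  finally show "(\<Sum>u\<in>insert v S. \<Sum>w\<in>insert v S. x u * x w * d u w) \<le> 0" .
qed

section \<open>Paths and distances in graphs and trees\<close>

context graph
begin

lemma apath_reverse:
  assumes "apath u p v"
  obtains q where "apath v q u" "length q = length p" "awalk_verts v q = rev (awalk_verts u p)"
proof -
  have "\<exists>q. awalk v q u \<and> length q = length p \<and> awalk_verts v q = rev (awalk_verts u p)"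
    if "awalk u p v" for u p v
    using that
  proof (induction p arbitrary: u)
    case (Cons e es)
    hence e: "e \<in> arcs G" "u = tail G e" and es: "awalk (head G e) es v"
      by (auto simp: awalk_Cons_iff)
    from Cons.IH[OF es] obtain q where q: "awalk v q (head G e)" "length q = length es"
      "awalk_verts v q = rev (awalk_verts (head G e) es)" by blast
    from e sym_arcs obtain e' where e': "e' \<in> arcs G" "tail G e' = head G e" "head G e' = tail G e"
      unfolding symmetric_conv by metis
    have l: "awlast v q = head G e" using q(1) by blast
    have w: "awalk v (q @ [e']) u"
      by (rule awalk_appendI[OF q(1)]) (use e e' in \<open>auto simp: awalk_simps\<close>)
    moreover note l
    ultimately show ?case
      using q e e' by (intro exI[of _ "q @ [e']"]) (auto simp: awalk_verts_append)
  qed (auto simp: awalk_Nil_iff)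
  thus thesis using assms that unfolding apath_def by (metis distinct_rev)
qed

lemma graph_dist_commute: "graph_dist G u v = graph_dist G v u"
proof -
  have "(\<exists>p. apath u p v \<and> length p = k) = (\<exists>p. apath v p u \<and> length p = k)" for k
    by (metis apath_reverse)
  thus ?thesis by (simp add: graph_dist_def)
qed

lemma graph_dist_self: "u \<in> verts G \<Longrightarrow> graph_dist G u u = 0"
  unfolding graph_dist_def by (rule Least_equality) (auto simp: apath_Nil_iff)

text \<open>The cut is at the first vertex in \<open>S\<close>. \<open>butlast\<close> removes just
  this vertex \<open>w\<close>, so the prefix \<open>q1\<close> meets \<open>S\<close> only at its
  end.\<close>

lemma awalk_first_hit:
  assumes "awalk v q u" "u \<in> S"
  obtains q1 w q2 where "q = q1 @ q2" "w \<in> S" "awalk v q1 w" "awalk w q2 u"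
    "set (butlast (awalk_verts v q1)) \<inter> S = {}"
proof -
  have "\<exists>q1 w q2. q = q1 @ q2 \<and> w \<in> S \<and> awalk v q1 w \<and> awalk w q2 u \<and>
          set (butlast (awalk_verts v q1)) \<inter> S = {}"
    using assms(1)
  proof (induction q arbitrary: v)
    case Nil
    thus ?case using assms(2) by (auto simp: awalk_Nil_iff)
  next
    case (Cons e es)
    show ?case
    proof (cases "v \<in> S")
      case True
      thus ?thesis using Cons.prems
        by (intro exI[of _ "[]"] exI[of _ v] exI[of _ "e # es"]) (auto simp: awalk_Nil_iff)
    next
      case False
      from Cons.prems have e: "e \<in> arcs G" "v = tail G e" "awalk (head G e) es u"
        by (auto simp: awalk_Cons_iff)
      from Cons.IH[OF e(3)] obtain q1 w q2 where "es = q1 @ q2" "w \<in> S"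
        "awalk (head G e) q1 w" "awalk w q2 u" "set (butlast (awalk_verts (head G e) q1)) \<inter> S = {}"
        by blast
      thus ?thesis using e False
        by (intro exI[of _ "e # q1"] exI[of _ w] exI[of _ q2]) (auto simp: awalk_Cons_iff)
    qed
  qed
  thus thesis using that by blast
qed

text \<open>A path that leaves \<open>S\<close> through a new vertex \<open>v\<close> and re-enters it elsewhere than through the
  given arc closes up to a cycle inside \<open>S\<close>.\<close>

lemma apath_from_pendant:
  assumes acyc: "\<not> (\<exists>p. cycle p \<and> 3 \<le> length p)" and conn: "connected G"
    and S: "path_convex G S" and a: "a \<in> arcs G" "tail G a \<notin> S" "head G a \<in> S"
    and u: "u \<in> S" and q: "apath (tail G a) q u"
  obtains q2 where "q = a # q2" "apath (head G a) q2 u"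
proof -
  define v where "v = tail G a"
  define p where "p = head G a"
  have vp: "v \<notin> S" "p \<in> S" using a by (auto simp: v_def p_def)
  have SV: "S \<subseteq> verts G" using S by (auto simp: path_convex_def)
  from a sym_arcs obtain a' where a': "a' \<in> arcs G" "tail G a' = p" "head G a' = v"
    unfolding symmetric_conv v_def p_def by metis
  have qw: "awalk v q u" using q by (auto simp: apath_def v_def)
  from awalk_first_hit[OF qw u] obtain q1 w q2 where q12: "q = q1 @ q2" "w \<in> S"
    "awalk v q1 w" "awalk w q2 u" "set (butlast (awalk_verts v q1)) \<inter> S = {}" .
  have last1: "awlast v q1 = w" using q12 by auto
  have ap: "apath v q1 w" "apath w q2 u"
    using q q12(1) last1 unfolding v_def[symmetric] by (auto simp: apath_append_iff)
  have "q1 \<noteq> []" using q12 vp by (auto simp: awalk_Nil_iff)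
  have "w \<rightarrow>\<^sup>* p"
    using symmetric_connected_imp_strongly_connected[OF sym_arcs conn] SV vp q12
    unfolding strongly_connected_def by blast
  then obtain r where r: "apath w r p" by (auto simp: reachable_apath)
  have rS: "set (awalk_verts w r) \<subseteq> S"
    using S r q12 vp unfolding path_convex_def by blast
  \<comment> \<open>The path \<open>q1\<close> from \<open>v\<close> to \<open>w\<close>, the path
    \<open>r\<close> from \<open>w\<close> to \<open>p\<close> inside \<open>S\<close> and the arc
    \<open>a'\<close> back to \<open>v\<close> would form a cycle if they had three or more arcs in
    total.\<close>
  have "length q1 + length r < 2"
  proof (rule ccontr)
    assume "\<not> length q1 + length r < 2"
    hence len: "3 \<le> length (q1 @ r @ [a'])" by simp
    have rw: "awalk w r p" using r by (simp add: apath_def)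
    have aw: "awalk v (q1 @ r @ [a']) v" "awalk w (r @ [a']) v"
      using q12 rw a' by (auto simp: awalk_Cons_iff awalk_Nil_iff)
    have "awalk_verts v (q1 @ r @ [a']) = awalk_verts v q1 @ tl (awalk_verts w (r @ [a']))"
      using awalk_verts_append[OF aw(1)] last1 by simp
    also have "awalk_verts w (r @ [a']) = awalk_verts w r @ [v]"
      using awalk_verts_append[OF aw(2)] rw a' by auto
    finally have vs: "tl (awalk_verts v (q1 @ r @ [a'])) =
        tl (awalk_verts v q1) @ tl (awalk_verts w r) @ [v]"
      by (metis append.assoc awalk_verts_non_Nil tl_append2)
    obtain zs where zs: "awalk_verts w r = w # zs"
      using rw by (cases "awalk_verts w r") auto
    obtain ys where ys: "awalk_verts v q1 = v # ys"
      using q12(3) by (cases "awalk_verts v q1") auto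
    have d: "distinct (w # zs)" "distinct (v # ys)"
      using zs ys r ap by (auto simp: apath_def)
    have zS: "set zs \<subseteq> S" using rS zs by auto
    have "awalk_verts v q1 = butlast (awalk_verts v q1) @ [w]"
      using append_butlast_last_id[OF awalk_verts_non_Nil, of v q1] last1 by simp
    from arg_cong[OF this, of set]
    have "set (awalk_verts v q1) = insert w (set (butlast (awalk_verts v q1)))"
      by (simp only: set_append list.set Un_insert_right Un_empty_right)
    moreover have "set ys \<subseteq> set (awalk_verts v q1)" by (simp add: ys subset_insertI)
    ultimately have "set ys \<subseteq> insert w (set (butlast (awalk_verts v q1)))" by simp
    \<comment> \<open>\<open>ys\<close> meets \<open>S\<close> at most in \<open>w\<close>, while
      \<open>zs\<close> lies in \<open>S\<close> and omits \<open>w\<close>.\<close>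
    hence "set ys \<inter> set zs = {}" using q12(5) zS d(1) by auto
    hence "distinct (tl (awalk_verts v (q1 @ r @ [a'])))"
      unfolding vs zs ys using d zS vp by auto
    hence "cycle (q1 @ r @ [a'])" unfolding cycle_def using aw(1) by blast
    thus False using acyc len by blast
  qed
  with \<open>q1 \<noteq> []\<close> have "length q1 = 1" "r = []" by (cases q1; cases r; auto)+
  then obtain b where b: "q1 = [b]" by (auto simp: length_Suc_conv)
  have "w = p" using r \<open>r = []\<close> by (simp add: apath_Nil_iff)
  \<comment> \<open>Only the ends of \<open>b\<close> are determined so far; the absence of parallel
    arcs makes it equal to \<open>a\<close>.\<close>
  hence "b \<in> arcs G" "arc_to_ends G b = arc_to_ends G a"
    using q12(3) unfolding b by (simp_all add: awalk_Cons_iff awalk_Nil_iff arc_to_ends_def v_def p_def)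
  hence "b = a" using no_multi_arcs a(1) by blast
  thus thesis using that q12 b ap \<open>w = p\<close> by (simp add: p_def)
qed


text \<open>Paths from the new vertex to \<open>u\<close> are exactly the paths from
  \<open>head G a\<close> to \<open>u\<close> prolonged by \<open>a\<close>: the latter stay in
  \<open>S\<close> and so avoid the new vertex. The sets of lengths differ by a shift.\<close>

lemma graph_dist_pendant:
  assumes acyc: "\<not> (\<exists>p. cycle p \<and> 3 \<le> length p)" and conn: "connected G"
    and S: "path_convex G S" and a: "a \<in> arcs G" "tail G a \<notin> S" "head G a \<in> S"
    and u: "u \<in> S"
  shows "graph_dist G (tail G a) u = Suc (graph_dist G (head G a) u)"
proof -
  define P where "P k \<longleftrightarrow> (\<exists>q. apath (head G a) q u \<and> length q = k)" for k
  have eq: "(\<exists>q. apath (tail G a) q u \<and> length q = k) \<longleftrightarrow> (\<exists>j. k = Suc j \<and> P j)" for k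
  proof
    assume "\<exists>q. apath (tail G a) q u \<and> length q = k"
    then obtain q where q: "apath (tail G a) q u" "length q = k" by blast
    obtain q2 where "q = a # q2" "apath (head G a) q2 u"
      using apath_from_pendant[OF acyc conn S a u q(1)] .
    thus "\<exists>j. k = Suc j \<and> P j" unfolding P_def using q(2) by auto
  next
    assume "\<exists>j. k = Suc j \<and> P j"
    then obtain q where q: "apath (head G a) q u" "k = Suc (length q)"
      unfolding P_def by blast
    have "set (awalk_verts (head G a) q) \<subseteq> S"
      using S a(3) u q(1) unfolding path_convex_def by blast
    hence "apath (tail G a) (a # q) u" using q(1) a(1,2) by (auto simp: apath_Cons_iff)
    moreover have "length (a # q) = k" using q(2) by simp
    ultimately show "\<exists>q. apath (tail G a) q u \<and> length q = k" by blast
  qed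
  \<comment> \<open>Connectedness provides a path, so that \<open>LEAST\<close> ranges over a
    nonempty set of lengths.\<close>
  have "head G a \<in> verts G" "u \<in> verts G"
    using S a(3) u unfolding path_convex_def by auto
  hence "head G a \<rightarrow>\<^sup>* u"
    using symmetric_connected_imp_strongly_connected[OF sym_arcs conn]
    unfolding strongly_connected_def by simp
  then obtain q where "apath (head G a) q u" unfolding reachable_apath ..
  hence k: "P (length q)" unfolding P_def by blast
  have "(LEAST k. \<exists>j. k = Suc j \<and> P j) = Suc (LEAST j. P j)"
  proof (rule Least_equality)
    show "\<exists>j. Suc (LEAST j. P j) = Suc j \<and> P j" using LeastI[of P, OF k] by simp
  next
    fix k assume "\<exists>j. k = Suc j \<and> P j"
    then obtain j where "k = Suc j" "P j" by blast
    thus "Suc (LEAST j. P j) \<le> k" using Least_le[of P j] by simp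
  qed
  thus ?thesis unfolding graph_dist_def eq by (simp add: P_def)
qed

text \<open>A path from the new vertex into \<open>S\<close> starts with \<open>a\<close> and then
  stays in \<open>S\<close>; paths in the other direction are reversals of these, and a path from
  the new vertex to itself is empty.\<close>

lemma path_convex_insert:
  assumes acyc: "\<not> (\<exists>p. cycle p \<and> 3 \<le> length p)" and conn: "connected G"
    and S: "path_convex G S" and a: "a \<in> arcs G" "tail G a \<notin> S" "head G a \<in> S"
  shows "path_convex G (insert (tail G a) S)"
proof -
  define v where "v = tail G a"
  have out: "set (awalk_verts v q) \<subseteq> insert v S" if "u \<in> S" "apath v q u" for u q
  proof -
    from apath_from_pendant[OF acyc conn S a that(1)] that(2)
    obtain q2 where q2: "q = a # q2" "apath (head G a) q2 u" unfolding v_def by metis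
    hence "set (awalk_verts (head G a) q2) \<subseteq> S"
      using S a(3) that(1) unfolding path_convex_def by blast
    moreover have "awalk_verts v q = v # awalk_verts (head G a) q2" by (simp add: q2 v_def)
    ultimately show ?thesis by auto
  qed
  have "set (awalk_verts u q) \<subseteq> insert v S"
    if uw: "u \<in> insert v S" "w \<in> insert v S" and q: "apath u q w" for u w q
  proof -
    consider "u \<in> S" "w \<in> S" | "u = v" "w = v" | "u = v" "w \<in> S" | "u \<in> S" "w = v"
      using uw by blast
    thus ?thesis
    proof cases
      case 1
      thus ?thesis using S q unfolding path_convex_def by blast
    next
      case 2
      hence "q = []" using apath_nonempty_ends[OF q] by blast
      thus ?thesis using 2 by simp
    next
      case 3
      thus ?thesis using out q by blast
    next
      case 4
      obtain q' where "apath w q' u" "awalk_verts w q' = rev (awalk_verts u q)"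
        using apath_reverse[OF q] .
      thus ?thesis using out 4 by (metis set_rev)
    qed
  qed
  thus ?thesis using S a(1) unfolding path_convex_def v_def by auto
qed

lemma arc_into:
  assumes "awalk t q u" "t \<notin> S" "u \<in> S"
  obtains a where "a \<in> arcs G" "tail G a \<notin> S" "head G a \<in> S"
proof -
  have "\<exists>a\<in>arcs G. tail G a \<notin> S \<and> head G a \<in> S"
    using assms by (induction q arbitrary: t) (auto simp: awalk_Cons_iff awalk_Nil_iff)
  thus thesis using that by blast
qed

text \<open>A path-convex set is grown from a single vertex. Each new vertex is pendant with respect
  to the current set, so negative type is inherited, and the set of full size is
  \<open>verts G\<close>.\<close>

lemma neg_type_on_graph_dist:
  assumes acyc: "\<not> (\<exists>p. cycle p \<and> 3 \<le> length p)" and conn: "connected G"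
  shows "neg_type_on (verts G) (\<lambda>u v. real (graph_dist G u v))"
proof -
  let ?d = "\<lambda>u v. real (graph_dist G u v)"
  have sc: "strongly_connected G"
    by (rule symmetric_connected_imp_strongly_connected[OF sym_arcs conn])
  hence ne: "verts G \<noteq> {}" by (simp add: strongly_connected_def)
  have "\<exists>S. card S = k \<and> path_convex G S \<and> neg_type_on S ?d"
    if "1 \<le> k" "k \<le> card (verts G)" for k
    using that
  proof (induction k rule: nat_induct_at_least)
    case base
    obtain r where r: "r \<in> verts G" using ne by blast
    have "path_convex G {r}"
      unfolding path_convex_def
    proof (intro conjI ballI allI impI)
      fix u w q assume "u \<in> {r}" "w \<in> {r}" "apath u q w"
      moreover from this have "q = []" using apath_nonempty_ends[of u q w] by auto
      ultimately show "set (awalk_verts u q) \<subseteq> {r}" by simp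
    qed (use r in simp)
    moreover have "neg_type_on {r} ?d" by (simp add: neg_type_on_def)
    ultimately show ?case by (intro exI[of _ "{r}"]) simp
  next
    case (Suc k)
    then obtain S where S: "card S = k" "path_convex G S" "neg_type_on S ?d" by auto
    have SV: "S \<subseteq> verts G" using S by (simp add: path_convex_def)
    have fin: "finite S" by (rule finite_subset[OF SV finite_verts])
    have "S \<noteq> {}" using S(1) Suc.hyps by auto
    then obtain u where u: "u \<in> S" by blast
    have "S \<noteq> verts G" using S(1) Suc.prems by auto
    then obtain t where t: "t \<in> verts G" "t \<notin> S" using SV by blast
    have "t \<rightarrow>\<^sup>* u" using sc t u SV unfolding strongly_connected_def by blast
    then obtain q where "awalk t q u" by (auto simp: reachable_awalk)
    from arc_into[OF this t(2) u]
    obtain a where a: "a \<in> arcs G" "tail G a \<notin> S" "head G a \<in> S" .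
    have "real (graph_dist G (tail G a) w) = 1 + real (graph_dist G (head G a) w)"
      if "w \<in> S" for w
      using graph_dist_pendant[OF acyc conn S(2) a that] by simp
    moreover have "graph_dist G (tail G a) (tail G a) = 0" "graph_dist G (head G a) (head G a) = 0"
      using a(1) by (simp_all add: graph_dist_self)
    ultimately have "neg_type_on (insert (tail G a) S) ?d"
      by (intro neg_type_on_insert_pendant[where p = "head G a", OF fin a(2,3) S(3)])
        (simp_all add: graph_dist_commute)
    moreover have "card (insert (tail G a) S) = Suc k" using a fin S by simp
    ultimately show ?case using path_convex_insert[OF acyc conn S(2) a] by blast
  qed
  moreover have "1 \<le> card (verts G)" using ne by (simp add: Suc_leI card_gt_0_iff)
  ultimately obtain S where S: "card S = card (verts G)" "path_convex G S" "neg_type_on S ?d"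
    by blast
  have "S = verts G" using S by (intro card_subset_eq) (auto simp: path_convex_def)
  thus ?thesis using S by simp
qed

end


section \<open>Real-rooted polynomials\<close>

text \<open>Expressed by complex zeros, so that zeros can come from the fundamental theorem of
  algebra and a derivative can be tested at a single non-real point. Nonzero constants
  qualify.\<close>

definition real_rooted :: "real poly \<Rightarrow> bool" where
  "real_rooted p \<longleftrightarrow> p \<noteq> 0 \<and> (\<forall>z. poly (map_poly complex_of_real p) z = 0 \<longrightarrow> Im z = 0)"

abbreviation root_poly :: "real list \<Rightarrow> real poly" where
  "root_poly rs \<equiv> (\<Prod>r\<leftarrow>rs. [:- r, 1:])"

lemma poly_map_of_real_simps:
  "poly (map_poly complex_of_real (p * q)) z =
     poly (map_poly of_real p) z * poly (map_poly of_real q) z"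
  "poly (map_poly complex_of_real (p + q)) z =
     poly (map_poly of_real p) z + poly (map_poly of_real q) z"
  "poly (map_poly complex_of_real (Polynomial.smult c p)) z = of_real c * poly (map_poly of_real p) z"
proof -
  interpret map_poly_comm_ring_hom complex_of_real ..
  show "poly (map_poly complex_of_real (p * q)) z =
      poly (map_poly of_real p) z * poly (map_poly of_real q) z"
    by (simp add: hom_mult)
  show "poly (map_poly complex_of_real (p + q)) z =
      poly (map_poly of_real p) z + poly (map_poly of_real q) z"
    by (simp add: hom_add)
  show "poly (map_poly complex_of_real (Polynomial.smult c p)) z =
      of_real c * poly (map_poly of_real p) z"
    by (simp add: of_real_hom.map_poly_hom_smult)
qed

text \<open>Splitting off the linear factor of a zero leaves a real-rooted quotient, which allows
  induction on the degree.\<close>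

lemma real_rooted_split:
  assumes "real_rooted p"
  obtains rs where "p = Polynomial.smult (lead_coeff p) (root_poly rs)"
proof -
  have "\<exists>rs. p = Polynomial.smult (lead_coeff p) (root_poly rs)"
    using assms
  proof (induction "degree p" arbitrary: p)
    case 0
    then obtain c where "p = [:c:]" by (metis degree_eq_zeroE)
    thus ?case by (intro exI[of _ "[]"]) simp
  next
    case (Suc n)
    have "\<not> constant (poly (map_poly complex_of_real p))"
      using Suc.hyps(2) by (simp add: constant_degree degree_map_poly)
    then obtain z where z: "poly (map_poly complex_of_real p) z = 0"
      using fundamental_theorem_of_algebra by blast
    hence "Im z = 0" using Suc.prems by (simp add: real_rooted_def)
    then obtain r where r: "z = complex_of_real r" by (metis complex_is_Real_iff Reals_cases)
    have "poly p r = 0" using z unfolding r by (simp add: of_real_hom.poly_map_poly)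
    then obtain q where q: "p = [:- r, 1:] * q" unfolding poly_eq_0_iff_dvd dvd_def by blast
    have p0: "p \<noteq> 0" using Suc.prems by (simp add: real_rooted_def)
    hence q0: "q \<noteq> 0" using q by auto
    have "degree p = Suc (degree q)" unfolding q using q0 by (subst degree_mult_eq) auto
    moreover have "real_rooted q"
      using Suc.prems q0 unfolding real_rooted_def q
      by (auto simp: poly_map_of_real_simps simp del: mult_pCons_left)
    ultimately have "\<exists>rs. q = Polynomial.smult (lead_coeff q) (root_poly rs)"
      using Suc.hyps by simp
    then obtain rs where rs: "q = Polynomial.smult (lead_coeff q) (root_poly rs)" ..
    have "lead_coeff p = lead_coeff [:- r, 1:] * lead_coeff q" unfolding q by (rule lead_coeff_mult)
    also have "\<dots> = lead_coeff q" by simp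
    finally have lc: "lead_coeff p = lead_coeff q" .
    have "p = [:- r, 1:] * Polynomial.smult (lead_coeff q) (root_poly rs)"
      using q by (simp only: rs[symmetric])
    also have "\<dots> = Polynomial.smult (lead_coeff p) (root_poly (r # rs))"
      by (simp only: lc list.map prod_list.Cons mult_smult_right)
    finally show ?case by blast
  qed
  thus thesis using that by blast
qed

text \<open>The logarithmic derivative at \<open>z\<close> is the sum of the
  \<open>1 / (z - r)\<close>, whose imaginary parts all have the sign opposite to
  \<open>Im z\<close>, so it cannot vanish. To avoid division, \<open>D rs * cnj (F rs)\<close>
  replaces the quotient \<open>D rs / F rs\<close>.\<close>

lemma pderiv_root_poly_nonreal:
  assumes "rs \<noteq> []" "Im z \<noteq> 0"
  shows "poly (map_poly complex_of_real (pderiv (root_poly rs))) z \<noteq> 0"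
proof -
  define F where "F rs = poly (map_poly complex_of_real (root_poly rs)) z" for rs
  define D where "D rs = poly (map_poly complex_of_real (pderiv (root_poly rs))) z" for rs
  have F: "F (r # rs) = (z - of_real r) * F rs" for r rs
    by (simp add: F_def poly_map_of_real_simps map_poly_pCons del: mult_pCons_left)
  have D: "D (r # rs) = F rs + (z - of_real r) * D rs" for r rs
    by (simp add: F_def D_def pderiv_mult pderiv_pCons poly_map_of_real_simps map_poly_pCons del: mult_pCons_left)
  have F0: "F rs \<noteq> 0" for rs
  proof (induction rs)
    case (Cons r rs)
    have "z - of_real r \<noteq> 0" using assms(2) by (auto simp: complex_eq_iff)
    thus ?case using Cons F by simp
  qed (simp add: F_def)
  \<comment> \<open>The extra factor \<open>Im z\<close> treats the upper and the lower half-plane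
    together.\<close>
  have step: "Im (D (r # rs) * cnj (F (r # rs))) * Im z =
      - ((cmod (F rs) * Im z)\<^sup>2) + (cmod (z - of_real r))\<^sup>2 * (Im (D rs * cnj (F rs)) * Im z)" for r rs
  proof -
    have "D (r # rs) * cnj (F (r # rs)) = (F rs * cnj (F rs)) * cnj (z - of_real r)
        + ((z - of_real r) * cnj (z - of_real r)) * (D rs * cnj (F rs))"
      unfolding D F by (simp add: algebra_simps)
    also have "\<dots> = of_real ((cmod (F rs))\<^sup>2) * cnj (z - of_real r)
        + of_real ((cmod (z - of_real r))\<^sup>2) * (D rs * cnj (F rs))"
      by (simp only: complex_norm_square)
    finally have im: "Im (D (r # rs) * cnj (F (r # rs))) =
        - ((cmod (F rs))\<^sup>2 * Im z) + (cmod (z - of_real r))\<^sup>2 * Im (D rs * cnj (F rs))"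
      by simp
    have alg: "(- (a\<^sup>2 * y) + c * d) * y = - ((a * y)\<^sup>2) + c * (d * y)" for a c d y :: real
      by (simp add: power2_eq_square algebra_simps)
    show ?thesis unfolding im by (rule alg)
  qed
  have nonpos: "Im (D rs * cnj (F rs)) * Im z \<le> 0" for rs
  proof (induction rs)
    case (Cons r rs)
    have "(cmod (z - of_real r))\<^sup>2 * (Im (D rs * cnj (F rs)) * Im z) \<le> 0"
      by (rule mult_nonneg_nonpos[OF zero_le_power2 Cons.IH])
    thus ?case unfolding step using zero_le_power2[of "cmod (F rs) * Im z"] by linarith
  qed (simp add: D_def)
  obtain r rs' where "rs = r # rs'" using assms(1) by (cases rs) auto
  \<comment> \<open>Strictness comes from the square contributed by the first root, as
    \<open>F rs'\<close> and \<open>Im z\<close> are nonzero.\<close>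
  moreover have "Im (D (r # rs') * cnj (F (r # rs'))) * Im z < 0"
  proof -
    have "0 < (cmod (F rs') * Im z)\<^sup>2" using F0 assms(2) by simp
    moreover have "(cmod (z - of_real r))\<^sup>2 * (Im (D rs' * cnj (F rs')) * Im z) \<le> 0"
      by (rule mult_nonneg_nonpos[OF zero_le_power2 nonpos])
    ultimately show ?thesis unfolding step by linarith
  qed
  ultimately show ?thesis unfolding D_def[symmetric] by auto
qed

lemma real_rooted_pderiv:
  assumes "real_rooted p" "pderiv p \<noteq> 0"
  shows "real_rooted (pderiv p)"
proof -
  obtain rs where rs: "p = Polynomial.smult (lead_coeff p) (root_poly rs)"
    using real_rooted_split[OF assms(1)] .
  have "rs \<noteq> []"
  proof
    assume "rs = []"
    hence "pderiv p = 0" using rs by (metis list.simps(8) pderiv_1 pderiv_smult prod_list.Nil smult_0_right)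
    thus False using assms by blast
  qed
  have "lead_coeff p \<noteq> 0" using assms by (auto simp: real_rooted_def)
  moreover have "pderiv p = Polynomial.smult (lead_coeff p) (pderiv (root_poly rs))"
    by (subst rs) (simp add: pderiv_smult)
  ultimately show ?thesis
    using assms(2) pderiv_root_poly_nonreal[OF \<open>rs \<noteq> []\<close>]
    unfolding real_rooted_def by (auto simp: poly_map_of_real_simps)
qed

section \<open>Newton's inequalities\<close>

text \<open>The difference of the two sides is the sum, over the roots, of the squared products of
  all other roots. The induction follows the recursion of this sum, which also covers zero
  roots.\<close>

lemma laguerre_root_poly:
  "2 * coeff (root_poly rs) 0 * coeff (root_poly rs) 2 \<le> (coeff (root_poly rs) 1)\<^sup>2"
proof (induction rs)
  case (Cons r rs)
  define b where "b = coeff (root_poly rs)"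
  have c: "coeff (root_poly (r # rs)) 0 = - r * b 0" "coeff (root_poly (r # rs)) 1 = b 0 - r * b 1"
    "coeff (root_poly (r # rs)) 2 = b 1 - r * b 2"
    by (simp_all add: b_def coeff_pCons numeral_2_eq_2)
  have "(b 0 - r * b 1)\<^sup>2 - 2 * (- r * b 0) * (b 1 - r * b 2) = (b 0)\<^sup>2 + r\<^sup>2 * ((b 1)\<^sup>2 - 2 * b 0 * b 2)"
    by (simp add: power2_eq_square algebra_simps)
  also have "\<dots> \<ge> 0" using Cons.IH unfolding b_def by (intro add_nonneg_nonneg mult_nonneg_nonneg) auto
  finally show ?case unfolding c by simp
qed simp

lemma laguerre_real_rooted:
  assumes "real_rooted p"
  shows "2 * coeff p 0 * coeff p 2 \<le> (coeff p 1)\<^sup>2"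
proof -
  obtain rs where rs: "p = Polynomial.smult (lead_coeff p) (root_poly rs)"
    using real_rooted_split[OF assms] .
  show ?thesis
    using mult_left_mono[OF laguerre_root_poly[of rs] zero_le_power2[of "lead_coeff p"]]
    by (subst (1 2 3) rs) (simp add: power2_eq_square mult_ac)
qed

text \<open>Passing to the derivative lowers the index by one and produces factors of which
  \<open>(k + 1) * (k + 2)\<close> cancels, so induction reduces everything to the lowest three
  coefficients. This is Newton's inequality without its degree-dependent factor.\<close>

lemma newton_real_rooted:
  assumes "real_rooted p"
  shows "of_nat (Suc (Suc k)) * coeff p k * coeff p (Suc (Suc k)) \<le> of_nat (Suc k) * (coeff p (Suc k))\<^sup>2"
  using assms
proof (induction k arbitrary: p)
  case 0
  thus ?case using laguerre_real_rooted[of p] by (simp add: numeral_2_eq_2)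
next
  case (Suc k)
  show ?case
  proof (cases "pderiv p = 0")
    case True
    \<comment> \<open>A vanishing derivative is not real-rooted, so the induction hypothesis does
      not apply; the product on the left is zero instead.\<close>
    hence "degree p = 0" by (simp add: pderiv_eq_0_iff)
    hence "coeff p (Suc (Suc (Suc k))) = 0" by (intro coeff_eq_0) simp
    thus ?thesis by simp
  next
    case False
    from Suc.IH[OF real_rooted_pderiv[OF Suc.prems False]]
    have "of_nat (Suc (Suc k)) * (of_nat (Suc k) * coeff p (Suc k)) *
          (of_nat (Suc (Suc (Suc k))) * coeff p (Suc (Suc (Suc k))))
        \<le> of_nat (Suc k) * (of_nat (Suc (Suc k)) * coeff p (Suc (Suc k)))\<^sup>2"
      by (simp only: coeff_pderiv)
    hence "(of_nat (Suc k) * of_nat (Suc (Suc k))) *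
          (of_nat (Suc (Suc (Suc k))) * coeff p (Suc k) * coeff p (Suc (Suc (Suc k))))
        \<le> (of_nat (Suc k) * of_nat (Suc (Suc k))) * (of_nat (Suc (Suc k)) * (coeff p (Suc (Suc k)))\<^sup>2)"
      by (simp only: power2_eq_square mult_ac)
    thus ?thesis by (subst (asm) mult_le_cancel_left_pos) (simp_all del: of_nat_Suc)
  qed
qed

lemma log_concave_real_rooted:
  assumes "real_rooted p"
  shows "log_concave (coeff p) m"
  unfolding log_concave_def
proof (intro allI impI)
  fix j assume "1 \<le> j \<and> j < m"
  then obtain k where k: "j = Suc k" by (cases j) auto
  have "coeff p k * coeff p (Suc (Suc k)) \<le> (coeff p (Suc k))\<^sup>2"
  \<comment> \<open>Lowering the factor \<open>Suc (Suc k)\<close> to \<open>Suc k\<close> weakens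
    the inequality only for a positive product; otherwise the claim is trivial.\<close>
  proof (cases "coeff p k * coeff p (Suc (Suc k)) \<le> 0")
    case True
    thus ?thesis by (meson order_trans zero_le_power2)
  next
    case False
    hence "of_nat (Suc k) * (coeff p k * coeff p (Suc (Suc k)))
        \<le> of_nat (Suc (Suc k)) * (coeff p k * coeff p (Suc (Suc k)))"
      by (intro mult_right_mono) auto
    also have "\<dots> \<le> of_nat (Suc k) * (coeff p (Suc k))\<^sup>2"
      using newton_real_rooted[OF assms, of k] by (simp only: mult.assoc)
    finally show ?thesis by (subst (asm) mult_le_cancel_left_pos) (simp_all del: of_nat_Suc)
  qed
  thus "coeff p (j - 1) * coeff p (j + 1) \<le> (coeff p j)\<^sup>2" by (simp add: k)
qed

text \<open>This is the inequality \<open>2 e\<^sub>m \<le> e\<^sub>1 e\<^sub>m\<^sub>-\<^sub>1\<close> (\<open>m \<ge> 2\<close>) for the elementary symmetric functions of \<open>us\<close>.\<close>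

lemma coeff_nonneg_roots:
  fixes us :: "real list"
  defines "q \<equiv> \<lambda>us :: real list. \<Prod>u\<leftarrow>us. [:u, 1:]"
  assumes "\<forall>u\<in>set us. 0 \<le> u"
  shows "(\<forall>k. 0 \<le> coeff (q us) k) \<and> degree (q us) = length us \<and> coeff (q us) (length us) = 1
    \<and> (\<forall>k. Suc k = length us \<longrightarrow> coeff (q us) k = sum_list us)
    \<and> (\<forall>k. Suc k < length us \<longrightarrow> 2 * coeff (q us) k \<le> sum_list us * coeff (q us) (Suc k))"
  using assms(2)
proof (induction us)
  case Nil
  thus ?case by (auto simp: q_def)
next
  case (Cons u us)
  define N where "N = length us"
  define s where "s = sum_list us"
  define b where "b = coeff (q us)"
  have u: "0 \<le> u" and s: "0 \<le> s" using Cons.prems by (auto simp: s_def sum_list_nonneg)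
  from Cons have b0: "\<And>k. 0 \<le> b k" and deg: "degree (q us) = N" and bN: "b N = 1"
    and bs: "\<And>k. Suc k = N \<Longrightarrow> b k = s"
    and le: "\<And>k. Suc k < N \<Longrightarrow> 2 * b k \<le> s * b (Suc k)"
    by (auto simp: N_def b_def s_def)
  have cq: "q (u # us) = Polynomial.smult u (q us) + pCons 0 (q us)" by (simp add: q_def)
  have c0: "coeff (q (u # us)) 0 = u * b 0" by (simp add: cq b_def)
  have cS: "coeff (q (u # us)) (Suc k) = b k + u * b (Suc k)" for k
    by (simp add: cq b_def)
  have bhi: "b k = 0" if "N < k" for k using that deg by (simp add: b_def coeff_eq_0)
  have "q us \<noteq> 0" using bN b_def by auto
  moreover have "q (u # us) = [:u, 1:] * q us" by (simp add: q_def)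
  ultimately have "degree (q (u # us)) = Suc N"
    using deg by (simp add: degree_mult_eq del: mult_pCons_left)
  moreover have "0 \<le> coeff (q (u # us)) k" for k
    using b0 u by (cases k) (simp_all add: c0 cS)
  moreover have "coeff (q (u # us)) (Suc N) = 1" by (simp add: cS bN bhi)
  moreover have "coeff (q (u # us)) k = u + s" if "k = N" for k
  proof (cases k)
    case 0
    hence "us = []" using that by (simp add: N_def)
    thus ?thesis using 0 by (simp add: q_def s_def)
  next
    case (Suc j)
    thus ?thesis using that bN bs by (simp add: cS)
  qed
  moreover have "2 * coeff (q (u # us)) k \<le> (u + s) * coeff (q (u # us)) (Suc k)" if k: "k < N" for k
  proof -
    \<comment> \<open>The bound without the factor 2 also holds at the boundary
      \<open>Suc k = N\<close>, where it reads \<open>s \<le> s\<close>; the bound with it is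
      available only below.\<close>
    have le1: "u * b k \<le> u * (s * b (Suc k))"
    proof (rule mult_left_mono[OF _ u])
      show "b k \<le> s * b (Suc k)"
      proof (cases "Suc k = N")
        case False
        thus ?thesis using le[of k] b0[of k] k by simp
      qed (use bs[of k] bN in simp)
    qed
    have sq: "0 \<le> u * (u * b (Suc k))" using u b0 by simp
    show ?thesis
    proof (cases k)
      case 0
      have "0 \<le> s * b 0" using s b0 by simp
      thus ?thesis using le1 sq 0 by (simp add: c0 cS algebra_simps)
    next
      case (Suc j)
      have "2 * b j \<le> s * b k" using le[of j] k Suc by simp
      thus ?thesis using le1 sq Suc by (simp add: cS algebra_simps)
    qed
  qed
  ultimately show ?case by (simp add: N_def s_def)
qed

text \<open>With \<open>m = length us + 1 - k\<close>, so \<open>m \<ge> 2\<close>, the coefficient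
  is \<open>e\<^sub>m - e\<^sub>1 e\<^sub>m\<^sub>-\<^sub>1\<close>, and the bound on
  \<open>2 e\<^sub>m\<close> gives its sign. The second conclusion makes the zeros an initial
  segment.\<close>

lemma coeff_one_positive_root:
  fixes us :: "real list"
  assumes us: "\<forall>u\<in>set us. 0 \<le> u"
    and p: "p = [:- sum_list us, 1:] * (\<Prod>u\<leftarrow>us. [:u, 1:])"
    and k: "k < length us"
  shows "coeff p k \<le> 0" and "coeff p k = 0 \<Longrightarrow> 1 \<le> k \<Longrightarrow> coeff p (k - 1) = 0"
proof -
  define s where "s = sum_list us"
  define b where "b = coeff (\<Prod>u\<leftarrow>us. [:u, 1:])"
  have s: "0 \<le> s" using us by (auto simp: s_def sum_list_nonneg)
  have b0: "0 \<le> b k" for k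
    using coeff_nonneg_roots[OF us] by (auto simp: b_def)
  have le: "2 * b k \<le> s * b (Suc k)" if "Suc k < length us" for k
    using coeff_nonneg_roots[OF us] that by (auto simp: b_def s_def)
  have c0: "coeff p 0 = - s * b 0" by (simp add: p s_def b_def)
  have cS: "coeff p (Suc k) = b k - s * b (Suc k)" for k
    by (simp add: p s_def b_def)
  have sb: "0 \<le> s * b k" for k using s b0 by simp
  have np: "coeff p k \<le> 0" if "k < length us" for k
  proof (cases k)
    case (Suc j)
    thus ?thesis using le[of j] b0[of j] that by (simp add: cS)
  qed (use sb[of 0] in \<open>simp add: c0\<close>)
  show "coeff p k \<le> 0" using np k .
  assume z: "coeff p k = 0" and "1 \<le> k"
  then obtain j where j: "k = Suc j" by (cases k) auto
  \<comment> \<open>A zero coefficient means \<open>b j = s * b k\<close>, while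
    \<open>2 * b j \<le> s * b k\<close> and \<open>b j\<close> is nonnegative.\<close>
  have "b j = 0" using z le[of j] b0[of j] k by (simp add: j cS)
  hence "0 \<le> coeff p j" using b0 by (cases j) (simp_all add: c0 cS)
  thus "coeff p (k - 1) = 0" using np[of j] k by (simp add: j)
qed


section \<open>Eigenvalues of symmetric matrices\<close>

text \<open>Orthogonalised against \<open>f\<close>, the vector \<open>g\<close> becomes an
  eigenvector \<open>h\<close> for \<open>b\<close>. The form is positive definite on the plane
  spanned by \<open>f\<close> and \<open>h\<close>, which meets the hyperplane of sum zero
  nontrivially.\<close>

lemma symmetric_quadratic_form_pos:
  fixes A :: "nat \<Rightarrow> nat \<Rightarrow> real" and f g :: "nat \<Rightarrow> real"
  assumes sym: "\<And>i j. i < n \<Longrightarrow> j < n \<Longrightarrow> A i j = A j i"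
    and f: "\<And>i. i < n \<Longrightarrow> (\<Sum>j<n. A i j * f j) = a * f i"
    and g: "\<And>i. i < n \<Longrightarrow> (\<Sum>j<n. A i j * g j) = b * g i + c * f i"
    and pos: "0 < a" "0 < b"
    and f0: "i0 < n" "f i0 \<noteq> 0"
    and indep: "\<And>t. \<exists>i<n. g i \<noteq> t * f i"
  obtains x where "(\<Sum>i<n. x i) = 0" "0 < (\<Sum>i<n. \<Sum>j<n. x i * x j * A i j)"
proof -
  define ip where "ip x y = (\<Sum>i<n. x i * y i)" for x y :: "nat \<Rightarrow> real"
  define ap where "ap x i = (\<Sum>j<n. A i j * x j)" for x i
  have ip_pos: "0 < ip x x" if "i < n" "x i \<noteq> 0" for x i
    unfolding ip_def using that by (intro sum_pos2[of _ i]) (auto simp flip: power2_eq_square)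
  have ip_nonneg: "0 \<le> ip x x" for x unfolding ip_def by (simp add: sum_nonneg)
  have ip_cong: "ip x y = ip x y'" if "\<And>i. i < n \<Longrightarrow> y i = y' i" for x y y'
    unfolding ip_def using that by simp
  have ip_lin: "ip x (\<lambda>i. r * y i + s * z i) = r * ip x y + s * ip x z" for x y z r s
    unfolding ip_def by (simp add: sum_distrib_left algebra_simps sum.distrib)
  have ip_commute: "ip x y = ip y x" for x y unfolding ip_def by (simp add: mult.commute)
  have self_adjoint: "ip x (ap y) = ip y (ap x)" for x y
  proof -
    have "ip x (ap y) = (\<Sum>i<n. \<Sum>j<n. x i * (A i j * y j))"
      by (simp add: ip_def ap_def sum_distrib_left)
    also have "\<dots> = (\<Sum>j<n. \<Sum>i<n. x i * (A i j * y j))" by (rule sum.swap)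
    also have "\<dots> = (\<Sum>j<n. \<Sum>i<n. y j * (A j i * x i))"
      by (intro sum.cong) (auto simp: sym)
    also have "\<dots> = ip y (ap x)" by (simp add: ip_def ap_def sum_distrib_left)
    finally show ?thesis .
  qed
  have ap_lin: "ap (\<lambda>i. r * x i + s * y i) i = r * ap x i + s * ap y i" for x y r s i
    unfolding ap_def by (simp add: sum_distrib_left algebra_simps sum.distrib)
  have apf: "ap f i = a * f i" if "i < n" for i using f[OF that] by (simp add: ap_def)
  have apg: "ap g i = b * g i + c * f i" if "i < n" for i using g[OF that] by (simp add: ap_def)
  have ff: "0 < ip f f" using ip_pos f0 by blast
  \<comment> \<open>The Gram-Schmidt coefficient. The factor \<open>1\<close> in \<open>h\<close>
    gives it the shape that \<open>ip_lin\<close> and \<open>ap_lin\<close> rewrite.\<close>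
  define t where "t = ip f g / ip f f"
  define h where "h = (\<lambda>i. 1 * g i + (- t) * f i)"
  define c' where "c' = c + t * b - t * a"
  have fh: "ip f h = 0" unfolding h_def ip_lin using ff by (simp add: t_def)
  have aph: "ap h i = b * h i + c' * f i" if "i < n" for i
    unfolding h_def ap_lin apf[OF that] apg[OF that] by (simp add: c'_def algebra_simps)
  \<comment> \<open>By symmetry \<open>ap h\<close> is orthogonal to \<open>f\<close>, so its
    \<open>f\<close>-component \<open>c'\<close> vanishes.\<close>
  have "ip f (ap h) = ip h (ap f)" by (rule self_adjoint)
  also have "\<dots> = ip h (\<lambda>i. a * f i + 0 * f i)" by (rule ip_cong) (simp add: apf)
  also have "\<dots> = 0" unfolding ip_lin using fh by (simp add: ip_commute)
  finally have "ip f (\<lambda>i. b * h i + c' * f i) = 0"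
    using ip_cong[of "ap h" "\<lambda>i. b * h i + c' * f i" f] aph by simp
  hence "c' = 0" unfolding ip_lin using fh ff by simp
  hence aph': "ap h i = b * h i" if "i < n" for i using aph[OF that] by simp
  obtain i1 where "i1 < n" "h i1 \<noteq> 0" using indep[of t] by (auto simp: h_def)
  hence hh: "0 < ip h h" using ip_pos by blast
  have form: "(\<Sum>i<n. \<Sum>j<n. x i * x j * A i j) = ip x (ap x)" for x
    by (simp add: ip_def ap_def sum_distrib_left mult_ac)
  have val: "ip x (ap x) = s\<^sup>2 * a * ip f f + r\<^sup>2 * b * ip h h"
    if x: "x = (\<lambda>i. s * f i + r * h i)" for x s r
  proof -
    have "ip x (ap x) = ip x (\<lambda>i. (s * a) * f i + (r * b) * h i)"
      by (rule ip_cong) (simp add: x ap_lin apf aph')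
    also have "\<dots> = s * a * ip x f + r * b * ip x h" by (rule ip_lin)
    also have "ip x f = s * ip f f" unfolding ip_commute[of x f] unfolding x ip_lin by (simp add: fh)
    also have "ip x h = r * ip h h"
      unfolding ip_commute[of x h] unfolding x ip_lin ip_commute[of h f] by (simp add: fh)
    finally show ?thesis by (simp add: power2_eq_square algebra_simps)
  qed
  show thesis
  proof (cases "sum h {..<n} = 0")
    case True
    have "ip h (ap h) = b * ip h h"
      using val[of h 0 1] by simp
    thus ?thesis using that[of h] True hh pos by (simp add: form)
  next
    case False
    \<comment> \<open>These weights make the sum of \<open>x\<close> vanish. Since \<open>s\<close>
      is nonzero in this case, the \<open>f\<close> part alone makes the form positive.\<close>
    define s where "s = sum h {..<n}"
    define r where "r = - sum f {..<n}"
    define x where "x = (\<lambda>i. s * f i + r * h i)"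
    have "sum x {..<n} = s * sum f {..<n} + r * sum h {..<n}"
      by (simp add: x_def sum.distrib sum_distrib_left)
    also have "\<dots> = 0" by (simp add: s_def r_def)
    finally have "sum x {..<n} = 0" .
    moreover have "0 < s\<^sup>2 * a * ip f f" using False ff pos by (simp add: s_def)
    moreover have "0 \<le> r\<^sup>2 * b * ip h h" using hh pos by simp
    ultimately show ?thesis using that[of x] val[OF x_def] by (simp add: form)
  qed
qed

text \<open>The Hermitian form \<open>S\<close> of an eigenvector equals its own conjugate by
  symmetry, and it is \<open>z\<close> times the positive number \<open>N\<close>.\<close>

lemma real_rooted_char_poly_symmetric:
  fixes A :: "real mat"
  assumes A: "A \<in> carrier_mat n n"
    and sym: "\<And>i j. i < n \<Longrightarrow> j < n \<Longrightarrow> A $$ (i, j) = A $$ (j, i)"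
  shows "real_rooted (char_poly A)"
  unfolding real_rooted_def
proof (intro conjI allI impI)
  show "char_poly A \<noteq> 0" using degree_monic_char_poly[OF A] by auto
next
  fix z assume z: "poly (map_poly complex_of_real (char_poly A)) z = 0"
  define C where "C = map_mat complex_of_real A"
  have C: "C \<in> carrier_mat n n" using A by (simp add: C_def)
  have "eigenvalue C z"
    using z unfolding eigenvalue_root_char_poly[OF C] by (simp add: C_def of_real_hom.char_poly_hom[OF A])
  then obtain v where v: "v \<in> carrier_vec n" "v \<noteq> 0\<^sub>v n" "C *\<^sub>v v = z \<cdot>\<^sub>v v"
    using C unfolding eigenvalue_def eigenvector_def by auto
  have ev: "(\<Sum>j<n. of_real (A $$ (i, j)) * v $ j) = z * v $ i" if i: "i < n" for i
  proof -
    have "(C *\<^sub>v v) $ i = (\<Sum>j<n. of_real (A $$ (i, j)) * v $ j)"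
      using i A C v(1) by (simp add: scalar_prod_def C_def lessThan_atLeast0)
    thus ?thesis using v i by simp
  qed
  define S where "S = (\<Sum>i<n. cnj (v $ i) * (\<Sum>j<n. of_real (A $$ (i, j)) * v $ j))"
  define N where "N = (\<Sum>i<n. (cmod (v $ i))\<^sup>2)"
  have "cnj S = (\<Sum>i<n. \<Sum>j<n. v $ i * (of_real (A $$ (i, j)) * cnj (v $ j)))"
    by (simp add: S_def sum_distrib_left)
  also have "\<dots> = (\<Sum>j<n. \<Sum>i<n. v $ i * (of_real (A $$ (i, j)) * cnj (v $ j)))" by (rule sum.swap)
  also have "\<dots> = (\<Sum>j<n. \<Sum>i<n. cnj (v $ j) * (of_real (A $$ (j, i)) * v $ i))"
    by (intro sum.cong) (auto simp: sym)
  also have "\<dots> = S" by (simp add: S_def sum_distrib_left)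
  finally have "Im S = 0" by (simp add: complex_eq_iff)
  moreover have "S = (\<Sum>i<n. cnj (v $ i) * (z * v $ i))"
    unfolding S_def by (intro sum.cong refl) (simp only: ev lessThan_iff)
  hence "S = (\<Sum>i<n. z * of_real ((cmod (v $ i))\<^sup>2))"
    by (simp only: complex_norm_square mult_ac)
  hence "S = z * of_real N" by (simp add: N_def sum_distrib_left)
  moreover obtain i where "i < n" "v $ i \<noteq> 0" using v by (metis carrier_vecD eq_vecI index_zero_vec(1,2))
  hence "0 < N" unfolding N_def by (intro sum_pos2[of _ i]) auto
  ultimately show "Im z = 0" by simp
qed

lemma trace_mult_commute:
  fixes M N :: "real mat"
  assumes "M \<in> carrier_mat n n" "N \<in> carrier_mat n n"
  shows "(\<Sum>i<n. (M * N) $$ (i, i)) = (\<Sum>i<n. (N * M) $$ (i, i))"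
proof -
  have "(\<Sum>i<n. (M * N) $$ (i, i)) = (\<Sum>i<n. \<Sum>j<n. M $$ (i, j) * N $$ (j, i))"
    using assms by (intro sum.cong) (auto simp: scalar_prod_def lessThan_atLeast0)
  also have "\<dots> = (\<Sum>j<n. \<Sum>i<n. M $$ (i, j) * N $$ (j, i))" by (rule sum.swap)
  also have "\<dots> = (\<Sum>i<n. (N * M) $$ (i, i))"
    using assms by (intro sum.cong) (auto simp: scalar_prod_def lessThan_atLeast0 mult.commute)
  finally show ?thesis .
qed

text \<open>The Schur form carries \<open>es\<close> on its diagonal, and similarity preserves the
  trace.\<close>

lemma sum_eigenvalues_eq_trace:
  fixes A :: "real mat"
  assumes A: "A \<in> carrier_mat n n" and es: "char_poly A = root_poly es"
  shows "sum_list es = (\<Sum>i<n. A $$ (i, i))" and "length es = n"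
proof -
  obtain B P Q where "schur_decomposition A es = (B, P, Q)" by (metis prod_cases3)
  from schur_decomposition[OF A es this]
  have sim: "similar_mat_wit A B P Q" and diag: "diag_mat B = es" by auto
  note w = similar_mat_witD2[OF A sim]
  show "length es = n" using w unfolding diag[symmetric] by (simp add: diag_mat_def)
  have "(\<Sum>i<n. A $$ (i, i)) = (\<Sum>i<n. (P * (B * Q)) $$ (i, i))"
    using w by (simp add: assoc_mult_mat[of P n n B n Q n])
  also have "\<dots> = (\<Sum>i<n. ((B * Q) * P) $$ (i, i))"
    using w by (intro trace_mult_commute) auto
  also have "(B * Q) * P = B" using w by (simp add: assoc_mult_mat[of B n n Q n P n])
  also have "(\<Sum>i<n. B $$ (i, i)) = sum_list es"
    using w unfolding diag[symmetric]
    by (simp add: diag_mat_def sum_list_sum_nth lessThan_atLeast0)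
  finally show "sum_list es = (\<Sum>i<n. A $$ (i, i))" ..
qed

text \<open>A Schur form \<open>B\<close> with \<open>a\<close> and \<open>b\<close> leading its
  diagonal satisfies \<open>A * P = P * B\<close>, so the first two columns of \<open>P\<close>
  serve as \<open>f\<close> and \<open>g\<close> above, with \<open>c = B $$ (0, 1)\<close>. They
  are independent because \<open>P\<close> is invertible; the case \<open>a = b\<close> is
  covered.\<close>

lemma quadratic_form_pos_of_two_pos_eigenvalues:
  fixes A :: "real mat"
  assumes A: "A \<in> carrier_mat n n"
    and sym: "\<And>i j. i < n \<Longrightarrow> j < n \<Longrightarrow> A $$ (i, j) = A $$ (j, i)"
    and es: "char_poly A = root_poly (a # b # es)" and pos: "0 < a" "0 < b"
  obtains x where "(\<Sum>i<n. x i) = 0" "0 < (\<Sum>i<n. \<Sum>j<n. x i * x j * A $$ (i, j))"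
proof -
  obtain B P Q where "schur_decomposition A (a # b # es) = (B, P, Q)" by (metis prod_cases3)
  from schur_decomposition[OF A es this]
  have sim: "similar_mat_wit A B P Q" and ut: "upper_triangular B"
    and diag: "diag_mat B = a # b # es" by auto
  note w = similar_mat_witD2[OF A sim]
  have n2: "2 \<le> n" using sum_eigenvalues_eq_trace(2)[OF A es] by auto
  have B: "B $$ (0, 0) = a" "B $$ (1, 1) = b"
  proof -
    have "diag_mat B ! i = B $$ (i, i)" if "i < n" for i
      using that w by (simp add: diag_mat_def)
    from this[of 0] this[of 1] show "B $$ (0, 0) = a" "B $$ (1, 1) = b"
      using n2 by (simp_all add: diag)
  qed
  have "A * P = P * B * (Q * P)"
    unfolding w(3) using w by (intro assoc_mult_mat[of _ n n _ n _ n]) auto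
  hence AP: "A * P = P * B" using w by simp
  have ent: "(\<Sum>j<n. A $$ (i, j) * P $$ (j, k)) = (\<Sum>j<n. P $$ (i, j) * B $$ (j, k))"
    if "i < n" "k < n" for i k
  proof -
    have "(A * P) $$ (i, k) = (\<Sum>j<n. A $$ (i, j) * P $$ (j, k))"
      using that w A by (simp add: scalar_prod_def lessThan_atLeast0)
    moreover have "(P * B) $$ (i, k) = (\<Sum>j<n. P $$ (i, j) * B $$ (j, k))"
      using that w by (simp add: scalar_prod_def lessThan_atLeast0)
    ultimately show ?thesis using AP by simp
  qed
  have QP: "(\<Sum>j<n. Q $$ (i, j) * P $$ (j, k)) = (if i = k then 1 else 0)"
    if "i < n" "k < n" for i k
  proof -
    have "(Q * P) $$ (i, k) = (\<Sum>j<n. Q $$ (i, j) * P $$ (j, k))"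
      using that w(6,7) by (simp add: scalar_prod_def lessThan_atLeast0)
    moreover have "(Q * P) $$ (i, k) = (if i = k then 1 else 0)" unfolding w(2) using that by simp
    ultimately show ?thesis by simp
  qed
  have B0: "B $$ (j, k) = 0" if "k < j" "j < n" for j k
    using ut that w unfolding upper_triangular_def by auto
  have f: "(\<Sum>j<n. A $$ (i, j) * P $$ (j, 0)) = a * P $$ (i, 0)" if "i < n" for i
  proof -
    have "(\<Sum>j<n. P $$ (i, j) * B $$ (j, 0)) = (\<Sum>j\<in>{0}. P $$ (i, j) * B $$ (j, 0))"
      using n2 B0 by (intro sum.mono_neutral_right) auto
    thus ?thesis using ent[OF that, of 0] n2 B by simp
  qed
  have g: "(\<Sum>j<n. A $$ (i, j) * P $$ (j, 1)) = b * P $$ (i, 1) + B $$ (0, 1) * P $$ (i, 0)"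
    if "i < n" for i
  proof -
    have "(\<Sum>j<n. P $$ (i, j) * B $$ (j, 1)) = (\<Sum>j\<in>{0, 1}. P $$ (i, j) * B $$ (j, 1))"
      using n2 B0 by (intro sum.mono_neutral_right) auto
    thus ?thesis using ent[OF that, of 1] n2 B by simp
  qed
  have "\<exists>i<n. P $$ (i, 0) \<noteq> 0"
  proof (rule ccontr)
    assume "\<not> (\<exists>i<n. P $$ (i, 0) \<noteq> 0)"
    hence "(\<Sum>j<n. Q $$ (0, j) * P $$ (j, 0)) = 0" by (intro sum.neutral) auto
    thus False using QP[of 0 0] n2 by simp
  qed
  then obtain i0 where i0: "i0 < n" "P $$ (i0, 0) \<noteq> 0" by blast
  have indep: "\<exists>i<n. P $$ (i, 1) \<noteq> t * P $$ (i, 0)" for t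
  proof (rule ccontr)
    assume "\<not> (\<exists>i<n. P $$ (i, 1) \<noteq> t * P $$ (i, 0))"
    hence "(\<Sum>j<n. Q $$ (1, j) * P $$ (j, 1)) = (\<Sum>j<n. t * (Q $$ (1, j) * P $$ (j, 0)))"
      by (intro sum.cong) auto
    also have "\<dots> = t * (\<Sum>j<n. Q $$ (1, j) * P $$ (j, 0))" by (simp add: sum_distrib_left)
    finally show False using QP[of 1 0] QP[of 1 1] n2 by simp
  qed
  show thesis
    by (rule symmetric_quadratic_form_pos[of n "\<lambda>i j. A $$ (i, j)" "\<lambda>i. P $$ (i, 0)" a
        "\<lambda>i. P $$ (i, 1)" b "B $$ (0, 1)" i0]) (use sym f g pos i0 indep that in auto)
qed

lemma root_poly_mset: "mset rs = mset ss \<Longrightarrow> root_poly rs = root_poly ss"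
  by (metis mset_map prod_mset_prod_list)

text \<open>Two positive eigenvalues would contradict \<open>neg\<close>. The zero trace then makes
  the remaining root the sum of the absolute values of the nonpositive ones.\<close>

lemma char_poly_one_positive_root:
  fixes A :: "real mat"
  assumes A: "A \<in> carrier_mat n n" and n: "0 < n"
    and sym: "\<And>i j. i < n \<Longrightarrow> j < n \<Longrightarrow> A $$ (i, j) = A $$ (j, i)"
    and tr: "\<And>i. i < n \<Longrightarrow> A $$ (i, i) = 0"
    and neg: "\<And>x. (\<Sum>i<n. x i) = 0 \<Longrightarrow> (\<Sum>i<n. \<Sum>j<n. x i * x j * A $$ (i, j)) \<le> 0"
  obtains us where "\<forall>u\<in>set us. 0 \<le> u" "length us = n - 1"
    "char_poly A = [:- sum_list us, 1:] * (\<Prod>u\<leftarrow>us. [:u, 1:])"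
proof -
  obtain es where "char_poly A = Polynomial.smult (lead_coeff (char_poly A)) (root_poly es)"
    using real_rooted_split[OF real_rooted_char_poly_symmetric[OF A sym]] by blast
  moreover have "lead_coeff (char_poly A) = 1" using degree_monic_char_poly[OF A] by simp
  ultimately have es: "char_poly A = root_poly es" by simp
  have len: "length es = n" and sum0: "sum_list es = 0"
    using sum_eigenvalues_eq_trace[OF A es] tr by auto
  \<comment> \<open>\<open>l\<close> is the positive root if there is one and an arbitrary root
    otherwise.\<close>
  have "\<exists>l rest. mset es = mset (l # rest) \<and> (\<forall>r\<in>set rest. r \<le> 0)"
  proof (cases "\<exists>e\<in>set es. 0 < e")
    case True
    then obtain l where l: "l \<in> set es" "0 < l" by blast
    hence m: "mset es = mset (l # remove1 l es)" by simp
    \<comment> \<open>\<open>remove1\<close> deletes one occurrence only, so a double positive root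
      is excluded as well.\<close>
    have "r \<le> 0" if r: "r \<in> set (remove1 l es)" for r
    proof (rule ccontr)
      assume "\<not> r \<le> 0"
      obtain ys zs where "remove1 l es = ys @ r # zs" using r by (meson split_list)
      hence "mset es = mset (l # r # ys @ zs)" using m by simp
      hence cp: "char_poly A = root_poly (l # r # ys @ zs)"
        using es root_poly_mset by metis
      have r_pos: "0 < r" using \<open>\<not> r \<le> 0\<close> by simp
      show False
      proof (rule quadratic_form_pos_of_two_pos_eigenvalues[OF A _ cp l(2) r_pos])
        fix x :: "nat \<Rightarrow> real"
        assume "(\<Sum>i<n. x i) = 0" "0 < (\<Sum>i<n. \<Sum>j<n. x i * x j * A $$ (i, j))"
        thus False using neg[of x] by linarith
      qed (use sym in blast)
    qed
    thus ?thesis using m by blast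
  next
    case False
    obtain l rest where "es = l # rest" using len n by (cases es) auto
    thus ?thesis using False by (intro exI[of _ l] exI[of _ rest]) (auto simp: not_less)
  qed
  then obtain l rest where m: "mset es = mset (l # rest)" and rest: "\<forall>r\<in>set rest. r \<le> 0"
    by blast
  define us where "us = map uminus rest"
  have "sum_list es = l + sum_list rest" using m by (metis sum_list.Cons sum_mset_sum_list)
  moreover have "sum_list us = - sum_list rest" unfolding us_def by (induction rest) auto
  ultimately have l: "l = sum_list us" using sum0 by simp
  have "(\<Prod>u\<leftarrow>us. [:u, 1:]) = root_poly rest" by (simp add: us_def o_def)
  moreover have "char_poly A = root_poly (l # rest)" using es root_poly_mset[OF m] by simp
  ultimately have "char_poly A = [:- sum_list us, 1:] * (\<Prod>u\<leftarrow>us. [:u, 1:])"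
    by (simp only: l list.map prod_list.Cons)
  moreover have "length us = n - 1" using m len by (metis us_def length_map size_mset length_Cons diff_Suc_1)
  moreover have "\<forall>u\<in>set us. 0 \<le> u" using rest by (auto simp: us_def)
  ultimately show thesis using that by blast
qed


section \<open>Unimodality of the coefficients\<close>

text \<open>The peak is the first descent. From there log-concavity propagates the strict descent
  through positive terms, and \<open>z\<close> excludes a zero right after a positive term.\<close>

lemma unimodal_if_log_concave:
  assumes nn: "\<And>i. i \<le> m \<Longrightarrow> 0 \<le> a i" and lc: "log_concave a m"
    and z: "\<And>i. 1 \<le> i \<Longrightarrow> i \<le> m \<Longrightarrow> a i = 0 \<Longrightarrow> a (i - 1) = 0"
  shows "unimodal a m"
proof -
  \<comment> \<open>\<open>k = m\<close> is the fallback for a sequence that never descends.\<close>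
  define P where "P k \<longleftrightarrow> k = m \<or> a (Suc k) < a k" for k
  define k where "k = (LEAST k. P k)"
  have Pm: "P m" by (simp add: P_def)
  have Pk: "P k" and km: "k \<le> m" unfolding k_def by (rule LeastI[of P, OF Pm], rule Least_le[of P, OF Pm])
  have up: "a i \<le> a (Suc i)" if "i < k" for i
    using not_less_Least[of i P] that unfolding k_def P_def by auto
  have down: "a (Suc i) < a i" if "k \<le> i" "i < m" for i
    using that
  proof (induction i rule: dec_induct)
    case base
    thus ?case using Pk by (simp add: P_def)
  next
    case (step i)
    have lt: "a (Suc i) < a i" using step by simp
    have "a (Suc i) \<noteq> 0" using z[of "Suc i"] nn[of "Suc i"] lt step by auto
    hence pos: "0 < a (Suc i)" using nn[of "Suc i"] step by simp
    have "a i * a (Suc (Suc i)) \<le> a (Suc i) * a (Suc i)"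
      using lc step by (auto simp: log_concave_def power2_eq_square dest: spec[of _ "Suc i"])
    also have "\<dots> < a i * a (Suc i)" using lt pos by simp
    finally show ?case using lt pos by (simp add: mult_less_cancel_left)
  qed
  show ?thesis unfolding unimodal_def
  proof (intro exI[of _ k] conjI allI impI km)
    fix i assume "1 \<le> i \<and> i \<le> k"
    thus "a (i - 1) \<le> a i" using up[of "i - 1"] by (cases i) auto
  next
    fix i assume "k \<le> i \<and> i < m"
    thus "a (i + 1) \<le> a i" using down[of i] by simp
  qed
qed

text \<open>The weights multiply both sides of the inequality at \<open>j\<close> by the square of
  \<open>c * r ^ j\<close>.\<close>

lemma log_concave_geometric:
  assumes "log_concave a m" "0 < r"
  shows "log_concave (\<lambda>k. c * r ^ k * a k) m"
  unfolding log_concave_def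
proof (intro allI impI)
  fix j assume j: "1 \<le> j \<and> j < m"
  then obtain i where i: "j = Suc i" by (cases j) auto
  have "a i * a (i + 2) \<le> (a (Suc i))\<^sup>2"
    using assms(1) j i unfolding log_concave_def by (metis Suc_1 add_Suc_right diff_Suc_1 Suc_eq_plus1)
  hence "(c * r ^ Suc i)\<^sup>2 * (a i * a (i + 2)) \<le> (c * r ^ Suc i)\<^sup>2 * (a (Suc i))\<^sup>2"
    by (intro mult_left_mono) auto
  thus "c * r ^ (j - 1) * a (j - 1) * (c * r ^ (j + 1) * a (j + 1)) \<le> (c * r ^ j * a j)\<^sup>2"
    by (simp add: i power2_eq_square mult_ac)
qed

section \<open>The distance characteristic polynomial of a tree\<close>

lemma dist_delta_eq:
  "dist_delta T vs k = (-1) ^ length vs * coeff (dist_char_poly T vs) k"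
proof -
  define n where "n = length vs"
  define D where "D = dist_matrix T vs"
  have D: "D \<in> carrier_mat n n" by (simp add: D_def n_def dist_matrix_def)
  have "map_mat (\<lambda>a. [:a:]) D - [:0, 1:] \<cdot>\<^sub>m 1\<^sub>m n = (-1) \<cdot>\<^sub>m char_poly_matrix D"
    using D by (intro eq_matI) (auto simp: char_poly_matrix_def)
  hence "det (map_mat (\<lambda>a. [:a:]) D - [:0, 1:] \<cdot>\<^sub>m 1\<^sub>m n) = (-1) ^ n * char_poly D"
    using carrier_matD(2)[OF char_poly_matrix_closed[OF D]] by (simp add: char_poly_def)
  also have "(-1 :: real poly) ^ n = [:(-1) ^ n:]" by (induction n) (auto simp: one_pCons)
  finally show ?thesis by (simp add: dist_delta_def dist_char_poly_def D_def n_def)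
qed

text \<open>Passes from vertices to matrix indices: \<open>y\<close> is \<open>x\<close> carried
  along the enumeration \<open>vs\<close>.\<close>

lemma neg_type_on_nth:
  assumes nt: "neg_type_on (set vs) d" and vs: "distinct vs" and x: "(\<Sum>i<length vs. x i) = 0"
  shows "(\<Sum>i<length vs. \<Sum>j<length vs. x i * x j * d (vs ! i) (vs ! j)) \<le> 0"
proof -
  have bij: "bij_betw ((!) vs) {..<length vs} (set vs)" using bij_betw_nth[OF vs refl refl] .
  define y where "y u = x (inv_into {..<length vs} ((!) vs) u)" for u
  have y: "y (vs ! i) = x i" if "i < length vs" for i
    using bij that by (simp add: y_def bij_betw_def)
  have "(\<Sum>u\<in>set vs. y u) = (\<Sum>i<length vs. y (vs ! i))"
    by (rule sum.reindex_bij_betw[OF bij, symmetric])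
  also have "\<dots> = 0" using x by (simp add: y)
  finally have "(\<Sum>u\<in>set vs. \<Sum>w\<in>set vs. y u * y w * d u w) \<le> 0"
    using nt by (simp add: neg_type_on_def)
  also have "(\<Sum>u\<in>set vs. \<Sum>w\<in>set vs. y u * y w * d u w) =
      (\<Sum>i<length vs. \<Sum>j<length vs. y (vs ! i) * y (vs ! j) * d (vs ! i) (vs ! j))"
    by (simp only: sum.reindex_bij_betw[OF bij, symmetric])
  finally show ?thesis by (simp add: y)
qed

theorem theorem2p1:
  fixes T :: "('a, 'b) pre_digraph" and vs :: "'a list" and n :: nat
  assumes "undirected_tree T"
    and "n = card (verts T)" and "n \<ge> 3"
    and "distinct vs" and "set vs = verts T"
  shows "log_concave (\<lambda>k. poly.coeff (dist_char_poly T vs) k) n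
    \<and> (log_concave (\<lambda>k. \<bar>dist_delta T vs k\<bar>) (n - 2)
       \<and> unimodal (\<lambda>k. \<bar>dist_delta T vs k\<bar>) (n - 2))
    \<and> (log_concave (dist_normalized_coeff T vs) (n - 2)
       \<and> unimodal (dist_normalized_coeff T vs) (n - 2))"
proof -
  interpret graph T using assms(1) by (simp add: undirected_tree_def)
  have acyc: "\<not> (\<exists>p. cycle p \<and> 3 \<le> length p)" and conn: "connected T"
    using assms(1) by (auto simp: undirected_tree_def)
  define D where "D = dist_matrix T vs"
  define a where "a k = coeff (dist_char_poly T vs) k" for k
  have len: "length vs = n" using assms(2,4,5) by (metis distinct_card)
  have D: "D \<in> carrier_mat n n" by (simp add: D_def dist_matrix_def len)
  have ent: "D $$ (i, j) = real (graph_dist T (vs ! i) (vs ! j))" if "i < n" "j < n" for i j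
    using that by (simp add: D_def dist_matrix_def len)
  have sym: "D $$ (i, j) = D $$ (j, i)" if "i < n" "j < n" for i j
    using that by (simp add: ent graph_dist_commute)
  have tr: "D $$ (i, i) = 0" if "i < n" for i
    using that assms(5) len by (simp add: ent graph_dist_self flip: assms(5))
  have neg: "(\<Sum>i<n. \<Sum>j<n. x i * x j * D $$ (i, j)) \<le> 0" if "(\<Sum>i<n. x i) = 0" for x
    using neg_type_on_nth[OF _ assms(4), of "\<lambda>u v. real (graph_dist T u v)" x]
      neg_type_on_graph_dist[OF acyc conn] that assms(5)
    by (simp add: len ent)
  have n0: "0 < n" using assms(3) by simp
  obtain us where us: "\<forall>u\<in>set us. 0 \<le> u" "length us = n - 1"
    "char_poly D = [:- sum_list us, 1:] * (\<Prod>u\<leftarrow>us. [:u, 1:])"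
    by (rule char_poly_one_positive_root[OF D n0]) (use sym tr neg in blast)+
  \<comment> \<open>Since \<open>us\<close> has \<open>n - 1\<close> elements,
    \<open>k \<le> n - 2\<close> is the same as \<open>k < length us\<close>.\<close>
  have a: "a k \<le> 0" "a k = 0 \<Longrightarrow> 1 \<le> k \<Longrightarrow> a (k - 1) = 0" if "k \<le> n - 2" for k
    using coeff_one_positive_root[OF us(1,3), of k] us(2) assms(3) that
    by (auto simp: a_def dist_char_poly_def D_def)
  have lc: "log_concave a m" for m
    using log_concave_real_rooted[OF real_rooted_char_poly_symmetric[OF D sym]]
    by (simp add: a_def[abs_def] dist_char_poly_def D_def)
  have delta: "\<bar>dist_delta T vs k\<bar> = \<bar>a k\<bar>" for k
    by (simp add: dist_delta_eq a_def abs_mult power_abs)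
  have lc_abs: "log_concave (\<lambda>k. \<bar>dist_delta T vs k\<bar>) (n - 2)"
    unfolding log_concave_def
  proof (intro allI impI)
    fix j assume j: "1 \<le> j \<and> j < n - 2"
    have "a (j - 1) * a (j + 1) \<le> (a j)\<^sup>2" using lc[of n] j by (auto simp: log_concave_def)
    \<comment> \<open>Both factors are nonpositive, because
      \<open>j + 1 \<le> n - 2\<close>.\<close>
    moreover have "\<bar>a (j - 1)\<bar> * \<bar>a (j + 1)\<bar> = a (j - 1) * a (j + 1)"
    proof -
      have "a (j - 1) \<le> 0" "a (j + 1) \<le> 0" using j by (auto intro!: a(1))
      thus ?thesis by simp
    qed
    ultimately show "\<bar>dist_delta T vs (j - 1)\<bar> * \<bar>dist_delta T vs (j + 1)\<bar> \<le> \<bar>dist_delta T vs j\<bar>\<^sup>2"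
      by (simp add: delta)
  qed
  have norm: "dist_normalized_coeff T vs =
      (\<lambda>k. 1 / 2 ^ (card (verts T) - 2) * 2 ^ k * \<bar>dist_delta T vs k\<bar>)"
    by (simp add: fun_eq_iff dist_normalized_coeff_def)
  have lc_norm: "log_concave (dist_normalized_coeff T vs) (n - 2)"
    unfolding norm by (rule log_concave_geometric[OF lc_abs]) simp
  have "unimodal (\<lambda>k. \<bar>dist_delta T vs k\<bar>) (n - 2)"
    by (rule unimodal_if_log_concave[OF _ lc_abs]) (use a(2) in \<open>auto simp: delta\<close>)
  moreover have "unimodal (dist_normalized_coeff T vs) (n - 2)"
    by (rule unimodal_if_log_concave[OF _ lc_norm])
      (use a(2) in \<open>auto simp: dist_normalized_coeff_def delta\<close>)
  moreover have "log_concave (\<lambda>k. poly.coeff (dist_char_poly T vs) k) n"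
    using lc[of n] by (simp add: a_def[abs_def])
  ultimately show ?thesis using lc_abs lc_norm by blast
qed

end
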